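(* Let $\vartheta$ be a primitive random substitution on a finite alphabet $\mathcal A$, with non-empty RS-subshift $X_\vartheta$, such that some letter of $\mathcal A$ admits a splitting pair for $\vartheta$. Then $h_{\mathrm{top}}(X_\vartheta)>0$.
   Context: Let $\mathcal A=\{a_1,\dots,a_n\}$ be a finite alphabet, $\mathcal A^+$ the set of non-empty finite words over $\mathcal A$, and $\mathcal A^{\mathbb Z}$ the set of bi-infinite sequences. A random substitution (non-degenerate; the probabilities, all non-zero, play no role here and are suppressed) is a map $\vartheta$ assigning to each letter $a_i$ a non-empty finite set $\vartheta(a_i)\subset\mathcal A^+$ of realisations. A realisation of $\vartheta(u)$, for $u=u_1\cdots u_m\in\mathcal A^+$, is a word $x_1\cdots x_m$ with each $x_j\in\vartheta(u_j)$ chosen independently for each position. Realisations of $\vartheta^k(u)$ are defined inductively: $\vartheta^0$ is the identity, and the realisations of $\vartheta^{k+1}(u)$ are the realisations of $\vartheta(v)$ for $v$ a realisation of $\vartheta^k(u)$. $\vartheta$ is primitive if there is $k\in\mathbb N$ such that for all $1\le i,j\le n$ the letter $a_i$ is a subword of some realisation of $\vartheta^k(a_j)$. A word $u\in\mathcal A^+$ is $\vartheta$-legal if it is a subword of some realisation of $\vartheta^k(a_j)$ for some $k\in\mathbb N$ and some $j$. The RS-subshift is $X_\vartheta=\{w\in\mathcal A^{\mathbb Z}: \text{every finite non-empty subword of } w \text{ is } \vartheta\text{-legal}\}$. A word $u$ is a strong affix of a word $v$ if $u$ is both a prefix and a suffix of $v$. A letter $a$ admits a splitting pair for $\vartheta$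 if there exist realisations $u,v$ of $\vartheta(a)$ with $|u|\le|v|$ such that $u$ is not a strong affix of $v$. For a subshift $X$, $h_{\mathrm{top}}(X)=\lim_{\ell\to\infty}\frac{\log C(\ell)}{\ell}$, where $C(\ell)$ is the number of words of length $\ell$ occurring in elements of $X$. *)

theory Defs
  imports Complex_Main "HOL-Library.Sublist"
begin

text \<open>
  The alphabet is the set of all elements of a type of class \<open>finite\<close>. Subwords are
  contiguous, i.e. \<^const>\<open>sublist\<close> (not \<open>subseq\<close>).
\<close>

definition random_substitution :: "('a::finite \<Rightarrow> 'a list set) \<Rightarrow> bool" where
  "random_substitution \<theta> \<longleftrightarrow> (\<forall>a. finite (\<theta> a) \<and> \<theta> a \<noteq> {} \<and> [] \<notin> \<theta> a)"

definition realisations :: "('a \<Rightarrow> 'a list set) \<Rightarrow> 'a list \<Rightarrow> 'a list set" where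
  "realisations \<theta> u = {concat xs |xs. list_all2 (\<lambda>x a. x \<in> \<theta> a) xs u}"

primrec iter_realisations :: "('a \<Rightarrow> 'a list set) \<Rightarrow> nat \<Rightarrow> 'a list \<Rightarrow> 'a list set" where
  "iter_realisations \<theta> 0 u = {u}"
| "iter_realisations \<theta> (Suc k) u = (\<Union>v \<in> iter_realisations \<theta> k u. realisations \<theta> v)"

text \<open>
  Allowing \<open>k = 0\<close> is harmless in the next definition: it only matters for a one-letter
  alphabet, where \<open>k = 1\<close> works as well.
\<close>

definition primitive :: "('a::finite \<Rightarrow> 'a list set) \<Rightarrow> bool" where
  "primitive \<theta> \<longleftrightarrow> (\<exists>k. \<forall>a b. \<exists>v \<in> iter_realisations \<theta> k [b]. sublist [a] v)"

definition legal :: "('a \<Rightarrow> 'a list set) \<Rightarrow> 'a list \<Rightarrow> bool" where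
  "legal \<theta> u \<longleftrightarrow> u \<noteq> [] \<and> (\<exists>k a. \<exists>v \<in> iter_realisations \<theta> k [a]. sublist u v)"

definition factor :: "(int \<Rightarrow> 'a) \<Rightarrow> int \<Rightarrow> nat \<Rightarrow> 'a list" where
  "factor w i l = map (\<lambda>j. w (i + int j)) [0..<l]"

definition RS_subshift :: "('a \<Rightarrow> 'a list set) \<Rightarrow> (int \<Rightarrow> 'a) set" where
  "RS_subshift \<theta> = {w. \<forall>i l. l > 0 \<longrightarrow> legal \<theta> (factor w i l)}"

definition strong_affix :: "'a list \<Rightarrow> 'a list \<Rightarrow> bool" where
  "strong_affix u v \<longleftrightarrow> prefix u v \<and> suffix u v"

definition admits_splitting_pair :: "('a \<Rightarrow> 'a list set) \<Rightarrow> 'a \<Rightarrow> bool" where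
  "admits_splitting_pair \<theta> a \<longleftrightarrow>
     (\<exists>u \<in> \<theta> a. \<exists>v \<in> \<theta> a. length u \<le> length v \<and> \<not> strong_affix u v)"

definition complexity :: "(int \<Rightarrow> 'a) set \<Rightarrow> nat \<Rightarrow> nat" where
  "complexity X l = card {factor w i l |w i. w \<in> X}"

text \<open>
  \<^const>\<open>lim\<close> is unspecified on divergent sequences, so a statement about \<open>h_top\<close>
  can only be proved by also establishing that the limit exists.
\<close>

definition h_top :: "(int \<Rightarrow> 'a) set \<Rightarrow> real" where
  "h_top X = lim (\<lambda>l. ln (real (complexity X l)) / real l)"

end

theory Submission
  imports Defs
begin

text \<open>
  Neither word of a splitting pair \<open>u\<close>, \<open>v\<close> of a letter \<open>a\<close> is a prefix of the other, or neither
  is a suffix of the other. Hence the \<open>2\<^sup>N\<close> realisations obtained from a word with \<open>N\<close> occurrences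
  of \<open>a\<close> by choosing \<open>u\<close> or \<open>v\<close> at each of them remain distinct when they are extended, to the
  right or to the left respectively, to words of the subshift of a common length. By primitivity,
  a word of length \<open>n\<close> of the subshift has a realisation under some fixed power of the substitution
  in which \<open>a\<close> occurs at least \<open>n\<close> times and whose length is linear in \<open>n\<close>. So the complexity at
  \<open>K n\<close> is at least \<open>2\<^sup>n\<close> for a constant \<open>K\<close>, and the entropy, a limit by Fekete's lemma, is at
  least \<open>ln 2 / K\<close>.
\<close>

section \<open>Fekete's lemma\<close>

lemma subadditive_mult_add:
  fixes f :: "nat \<Rightarrow> real"
  assumes "\<And>m n. f (m + n) \<le> f m + f n"
  shows "f (q * m + r) \<le> real q * f m + f r"
proof (induction q)
  case (Suc q)
  have "f (Suc q * m + r) \<le> f m + f (q * m + r)"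
    using assms[of m "q * m + r"] by (simp add: add.assoc)
  with Suc show ?case by (simp add: algebra_simps)
qed simp

text \<open>The limit is the infimum \<open>L\<close> of the quotients over
  \<open>n \<ge> 1\<close>, which exists by nonnegativity. Fix \<open>m\<close> with quotient below
  \<open>L + e / 2\<close>. Dividing \<open>n\<close> by \<open>m\<close> with remainder bounds
  \<open>f n\<close> by \<open>(n / m) * f m\<close> plus a constant independent of
  \<open>n\<close>, and this constant vanishes after division by \<open>n\<close>.\<close>

lemma fekete_convergent:
  fixes f :: "nat \<Rightarrow> real"
  assumes sub: "\<And>m n. f (m + n) \<le> f m + f n" and nonneg: "\<And>n. 0 \<le> f n"
  shows "convergent (\<lambda>n. f n / real n)"
proof -
  define L where "L = (INF n\<in>{1..}. f n / real n)"
  have bdd: "bdd_below ((\<lambda>n. f n / real n) ` {1..})"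
    by (rule bdd_belowI[of _ 0]) (auto simp: nonneg)
  have "(\<lambda>n. f n / real n) \<longlonglongrightarrow> L"
  proof (rule LIMSEQ_I)
    fix e :: real assume e: "e > 0"
    have "\<exists>m\<in>{1..}. f m / real m < L + e / 2"
      using e cINF_less_iff[OF _ bdd, of "L + e / 2"] unfolding L_def by auto
    then obtain m where m: "m \<ge> 1" "f m / real m < L + e / 2" by auto
    \<comment> \<open>A bound for \<open>f\<close> at every possible remainder modulo
      \<open>m\<close>: a sum of nonnegative terms dominates each of them.\<close>
    define M where "M = (\<Sum>r<m. f r)"
    obtain N where N: "real N > 2 * M / e" using reals_Archimedean2 by blast
    have "norm (f n / real n - L) < e" if n: "n \<ge> max 1 N" for n
    proof -
      from n have n1: "n \<ge> 1" "real n > 2 * M / e" using N by auto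
      have "f (n mod m) \<le> M" unfolding M_def
        using m nonneg by (intro member_le_sum) auto
      moreover have "f (n div m * m + n mod m) \<le> real (n div m) * f m + f (n mod m)"
        using sub by (rule subadditive_mult_add)
      ultimately have "f n \<le> real (n div m) * f m + M" by simp
      also have "real (n div m) * f m \<le> real n / real m * f m"
        by (intro mult_right_mono nonneg of_nat_div_le_of_nat)
      finally have "f n \<le> real n * (f m / real m) + M" by simp
      then have "f n / real n \<le> f m / real m + M / real n"
        using n1 by (simp add: field_simps)
      moreover have "M / real n < e / 2" using n1 e by (simp add: field_simps)
      ultimately have "f n / real n < L + e" using m by linarith
      moreover have "L \<le> f n / real n" unfolding L_def using n1 by (intro cINF_lower[OF bdd]) auto
      ultimately show ?thesis using e by simp
    qed
    then show "\<exists>no. \<forall>n\<ge>no. norm (f n / real n - L) < e" by blast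
  qed
  then show ?thesis by (auto simp: convergent_def)
qed

section \<open>Factors and complexity\<close>

definition language :: "(int \<Rightarrow> 'a) set \<Rightarrow> 'a list set" where
  "language X = {factor w i l |w i l. w \<in> X}"

lemma length_factor [simp]: "length (factor w i l) = l"
  by (simp add: factor_def)

lemma factor_0 [simp]: "factor w i 0 = []"
  by (simp add: factor_def)

lemma nth_factor [simp]: "j < l \<Longrightarrow> factor w i l ! j = w (i + int j)"
  by (simp add: factor_def)

lemma factor_add: "factor w i (l + m) = factor w i l @ factor w (i + int l) m"
  by (rule nth_equalityI) (auto simp: nth_append)

lemma factor_Suc: "factor w i (Suc l) = w i # factor w (i + 1) l"
  using factor_add[of w i 1 l] by (simp add: factor_def)

lemma sublist_factor:
  assumes "i \<le> j" "j + int l \<le> i + int m"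
  shows "sublist (factor w j l) (factor w i m)"
proof -
  define p where "p = nat (j - i)"
  have j: "j = i + int p" and "p + l \<le> m" using assms by (auto simp: p_def)
  then obtain q where "m = p + (l + q)" by (metis add.assoc le_iff_add)
  then show ?thesis by (simp add: factor_add j)
qed

lemma finite_factors: "finite {factor w i l |w i. w \<in> (X :: (int \<Rightarrow> 'a::finite) set)}"
  by (rule finite_subset[OF _ finite_lists_length_eq[of UNIV l]]) auto

lemma complexity_ge_1:
  assumes "(X :: (int \<Rightarrow> 'a::finite) set) \<noteq> {}"
  shows "complexity X l \<ge> 1"
proof -
  have "{factor w i l |w i. w \<in> X} \<noteq> {}" using assms by auto
  then show ?thesis
    using finite_factors[of l X] by (simp add: complexity_def Suc_le_eq card_gt_0_iff)
qed

lemma complexity_add: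
  fixes X :: "(int \<Rightarrow> 'a::finite) set"
  shows "complexity X (l + m) \<le> complexity X l * complexity X m"
proof -
  let ?F = "\<lambda>l. {factor w i l |w i. w \<in> X}"
  have "?F (l + m) \<subseteq> (\<lambda>(x, y). x @ y) ` (?F l \<times> ?F m)"
    by (force simp: factor_add)
  then have "card (?F (l + m)) \<le> card (?F l \<times> ?F m)"
    by (rule surj_card_le[rotated]) (intro finite_cartesian_product finite_factors)
  then show ?thesis by (simp add: complexity_def card_cartesian_product)
qed

text \<open>Submultiplicativity of the complexity makes its logarithm subadditive, and non-emptiness
  of \<open>X\<close> makes it nonnegative, so Fekete's lemma applies.\<close>

lemma convergent_entropy:
  assumes "(X :: (int \<Rightarrow> 'a::finite) set) \<noteq> {}"
  shows "convergent (\<lambda>l. ln (real (complexity X l)) / real l)"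
proof (rule fekete_convergent)
  have pos: "0 < complexity X l" for l using complexity_ge_1[OF assms, of l] by simp
  show "ln (real (complexity X (l + m))) \<le> ln (real (complexity X l)) + ln (real (complexity X m))"
    for l m
  proof -
    have "real (complexity X (l + m)) \<le> real (complexity X l) * real (complexity X m)"
      using complexity_add[of X l m] by (metis of_nat_le_iff of_nat_mult)
    then show ?thesis using pos by (simp add: ln_mult_pos[symmetric])
  qed
  show "0 \<le> ln (real (complexity X l))" for l using complexity_ge_1[OF assms, of l] by simp
qed

text \<open>The words of \<open>S\<close> may have different lengths, so each is first extended to
  the right, inside a sequence containing it, to the length \<open>M\<close>. Two words with the
  same extension are both prefixes of it, hence comparable, hence equal; so the extension map is
  injective.\<close>

lemma complexity_ge_card_prefix_free:
  fixes X :: "(int \<Rightarrow> 'a::finite) set"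
  assumes lang: "S \<subseteq> language X" and len: "\<And>z. z \<in> S \<Longrightarrow> length z \<le> M"
    and free: "\<And>y z. y \<in> S \<Longrightarrow> z \<in> S \<Longrightarrow> prefix y z \<Longrightarrow> y = z"
  shows "card S \<le> complexity X M"
proof -
  let ?F = "{factor w i M |w i. w \<in> X}"
  have "\<exists>x\<in>?F. prefix z x" if z: "z \<in> S" for z
  proof -
    obtain w i l where w: "w \<in> X" "z = factor w i l" using lang z by (auto simp: language_def)
    moreover obtain q where "M = l + q" using len[OF z] w by (auto simp: le_iff_add)
    ultimately have "factor w i M \<in> ?F" "prefix z (factor w i M)" by (auto simp: factor_add)
    then show ?thesis by blast
  qed
  then have "\<forall>z\<in>S. \<exists>x. x \<in> ?F \<and> prefix z x" by blast
  then obtain e where e: "\<forall>z\<in>S. e z \<in> ?F \<and> prefix z (e z)" by (rule bchoice[THEN exE])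
  have "inj_on e S"
  proof (rule inj_onI)
    fix y z assume yz: "y \<in> S" "z \<in> S" "e y = e z"
    then have "prefix y (e z)" "prefix z (e z)" using e by force+
    then have "prefix y z \<or> prefix z y" by (rule prefix_same_cases)
    then show "y = z" using free yz by metis
  qed
  then have "card S \<le> card ?F" using e finite_factors by (intro card_inj_on_le[of e]) auto
  then show ?thesis by (simp add: complexity_def)
qed

text \<open>The mirror image of the prefix version: words are extended to the left, which is
  possible because sequences are indexed by all integers.\<close>

lemma complexity_ge_card_suffix_free:
  fixes X :: "(int \<Rightarrow> 'a::finite) set"
  assumes lang: "S \<subseteq> language X" and len: "\<And>z. z \<in> S \<Longrightarrow> length z \<le> M"
    and free: "\<And>y z. y \<in> S \<Longrightarrow> z \<in> S \<Longrightarrow> suffix y z \<Longrightarrow> y = z"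
  shows "card S \<le> complexity X M"
proof -
  let ?F = "{factor w i M |w i. w \<in> X}"
  have "\<exists>x\<in>?F. suffix z x" if z: "z \<in> S" for z
  proof -
    obtain w i l where w: "w \<in> X" "z = factor w i l" using lang z by (auto simp: language_def)
    moreover obtain q where "M = q + l" using len[OF z] w by (metis length_factor le_iff_add add.commute)
    ultimately have "factor w (i - int q) M = factor w (i - int q) q @ z"
      by (simp add: factor_add)
    then show ?thesis using w by (auto simp: suffix_def)
  qed
  then have "\<forall>z\<in>S. \<exists>x. x \<in> ?F \<and> suffix z x" by blast
  then obtain e where e: "\<forall>z\<in>S. e z \<in> ?F \<and> suffix z (e z)" by (rule bchoice[THEN exE])
  have "inj_on e S"
  proof (rule inj_onI)
    fix y z assume yz: "y \<in> S" "z \<in> S" "e y = e z"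
    then have "suffix y (e z)" "suffix z (e z)" using e by force+
    then have "suffix y z \<or> suffix z y" by (rule suffix_same_cases)
    then show "y = z" using free yz by metis
  qed
  then have "card S \<le> card ?F" using e finite_factors by (intro card_inj_on_le[of e]) auto
  then show ?thesis by (simp add: complexity_def)
qed

section \<open>Bi-infinite concatenation\<close>

lemma length_concat_ge:
  assumes "\<And>x. x \<in> set xs \<Longrightarrow> x \<noteq> []"
  shows "length xs \<le> length (concat xs)"
  using assms
proof (induction xs)
  case (Cons x xs)
  then show ?case by (cases x) auto
qed simp

text \<open>The finite concatenations form a chain of prefixes, and non-empty blocks make their
  lengths unbounded, so they determine one infinite word.\<close>

lemma infinite_concat:
  fixes B :: "nat \<Rightarrow> 'a list"
  assumes "\<And>j. B j \<noteq> []"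
  obtains s where "\<And>n. concat (map B [0..<n]) = map s [0..<length (concat (map B [0..<n]))]"
proof -
  let ?C = "\<lambda>n. concat (map B [0..<n])"
  have len: "n \<le> length (?C n)" for n
  proof -
    have "x \<noteq> []" if "x \<in> set (map B [0..<n])" for x using that assms by auto
    then show ?thesis using length_concat_ge[of "map B [0..<n]"] by simp
  qed
  have pre: "prefix (?C n) (?C m)" if "n \<le> m" for n m
    using that by (induction m rule: dec_induct) (auto intro: prefix_order.trans)
  \<comment> \<open>\<open>Suc i\<close> non-empty blocks already reach position \<open>i\<close>,
    so that letter can serve as \<open>s i\<close>; any two members of the chain agree where both
    are defined.\<close>
  have "?C n ! i = ?C (Suc i) ! i" if i: "i < length (?C n)" for n i
  proof -
    have i': "i < length (?C (Suc i))" using len[of "Suc i"] by linarith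
    consider "n \<le> Suc i" | "Suc i \<le> n" by linarith
    then show ?thesis
    proof cases
      case 1 then show ?thesis using pre[OF 1] i by (metis nth_append prefixE)
    next
      case 2 then show ?thesis using pre[OF 2] i' by (metis nth_append prefixE)
    qed
  qed
  then have "?C n = map (\<lambda>i. ?C (Suc i) ! i) [0..<length (?C n)]" for n
    by (intro nth_equalityI) auto
  then show ?thesis by (rule that)
qed

text \<open>Block \<open>B 0\<close> starts at position 0. The first conjunct locates the blocks
  from there on; the second places every factor inside a finite run of blocks, which is the form
  needed to check legality.\<close>

lemma bi_infinite_concat:
  fixes B :: "int \<Rightarrow> 'a list"
  assumes B: "\<And>j. B j \<noteq> []"
  shows "\<exists>w. (\<forall>n. factor w 0 (length (concat (factor B 0 n))) = concat (factor B 0 n)) \<and>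
    (\<forall>i l. \<exists>n. sublist (factor w i l) (concat (factor B (- int n) (n + n))))"
proof -
  let ?L = "\<lambda>n. concat (factor B (- int n) n)" and ?R = "\<lambda>n. concat (factor B 0 n)"
  obtain s where s: "\<And>n. concat (map (\<lambda>j. B (int j)) [0..<n]) =
      map s [0..<length (concat (map (\<lambda>j. B (int j)) [0..<n]))]"
    using B infinite_concat[of "\<lambda>j. B (int j)"] by blast
  \<comment> \<open>The left half is read backwards from position -1, as a one-sided concatenation
    of the reversed blocks \<open>B (- 1)\<close>, \<open>B (- 2)\<close>, and so on.\<close>
  let ?C = "\<lambda>n. concat (map (\<lambda>j. rev (B (- 1 - int j))) [0..<n])"
  obtain t where t: "\<And>n. ?C n = map t [0..<length (?C n)]"
    using B infinite_concat[of "\<lambda>j. rev (B (- 1 - int j))"] by blast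
  have L: "?L n = rev (?C n)" for n
  proof (induction n)
    case (Suc n)
    have "?L (Suc n) = B (- 1 - int n) @ ?L n" by (simp add: factor_Suc algebra_simps)
    with Suc show ?case by simp
  qed simp
  have len: "n \<le> length (concat (factor B i n))" for i n
  proof -
    have "x \<noteq> []" if "x \<in> set (factor B i n)" for x using that B by (auto simp: factor_def)
    then show ?thesis using length_concat_ge[of "factor B i n"] by simp
  qed
  define w where "w i = (if i \<ge> 0 then s (nat i) else t (nat (- i - 1)))" for i
  have "factor w 0 q = map s [0..<q]" for q
    by (rule nth_equalityI) (auto simp: w_def)
  moreover have "?R n = map s [0..<length (?R n)]" for n
    using s[of n] by (simp add: factor_def)
  ultimately have w_R: "factor w 0 (length (?R n)) = ?R n" for n by metis
  have neg: "factor w (- int p) p = rev (map t [0..<p])" for p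
  proof (rule nth_equalityI)
    fix j assume j: "j < length (factor w (- int p) p)"
    then have "nat (int p - int j - 1) = p - Suc j" by auto
    with j show "factor w (- int p) p ! j = rev (map t [0..<p]) ! j"
      by (simp add: w_def rev_nth)
  qed simp
  have w_L: "factor w (- int (length (?L n))) (length (?L n)) = ?L n" for n
    using t[of n] L[of n] neg[of "length (?L n)"] by simp
  show ?thesis
  proof (intro exI[of _ w] conjI allI)
    show "factor w 0 (length (?R n)) = ?R n" for n by (rule w_R)
    fix i l
    \<comment> \<open>As blocks are non-empty, \<open>n\<close> blocks on either side of the origin
      cover all positions from \<open>- n\<close> to \<open>n - 1\<close>, among them those of the
      factor.\<close>
    define n where "n = nat \<bar>i\<bar> + l"
    let ?p = "length (?L n)" and ?q = "length (?R n)"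
    have "nat \<bar>i\<bar> + l \<le> ?p" "nat \<bar>i\<bar> + l \<le> ?q"
      using len[of n "- int n"] len[of n 0] unfolding n_def by blast+
    then have "- int ?p \<le> i" "i + int l \<le> - int ?p + int (?p + ?q)" by linarith+
    then have "sublist (factor w i l) (factor w (- int ?p) (?p + ?q))" by (rule sublist_factor)
    also have "factor w (- int ?p) (?p + ?q) = concat (factor B (- int n) (n + n))"
      using w_L[of n] w_R[of n] by (simp add: factor_add)
    finally show "\<exists>n. sublist (factor w i l) (concat (factor B (- int n) (n + n)))" by blast
  qed
qed

section \<open>Realisations\<close>

lemma realisations_Nil [simp]: "realisations \<theta> [] = {[]}"
  by (auto simp: realisations_def)

lemma realisations_Cons: "realisations \<theta> (a # u) = {x @ y |x y. x \<in> \<theta> a \<and> y \<in> realisations \<theta> u}"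
  (is "?L = ?R")
proof
  show "?L \<subseteq> ?R" by (fastforce simp: realisations_def list_all2_Cons2)
  show "?R \<subseteq> ?L"
  proof
    fix z assume "z \<in> ?R"
    then obtain x xs where "x \<in> \<theta> a" "list_all2 (\<lambda>x a. x \<in> \<theta> a) xs u" "z = x @ concat xs"
      by (auto simp: realisations_def)
    then have "list_all2 (\<lambda>x a. x \<in> \<theta> a) (x # xs) (a # u)" "z = concat (x # xs)" by simp_all
    then show "z \<in> ?L" unfolding realisations_def by blast
  qed
qed

lemma realisations_append:
  "x \<in> realisations \<theta> u \<Longrightarrow> y \<in> realisations \<theta> v \<Longrightarrow> x @ y \<in> realisations \<theta> (u @ v)"
proof (induction u arbitrary: x)
  case (Cons a u)
  then obtain p q where pq: "x = p @ q" "p \<in> \<theta> a" "q \<in> realisations \<theta> u"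
    by (auto simp: realisations_Cons)
  then have "q @ y \<in> realisations \<theta> (u @ v)" using Cons by blast
  then have "p @ q @ y \<in> realisations \<theta> (a # u @ v)"
    using pq(2) unfolding realisations_Cons by blast
  then show ?case using pq(1) by simp
qed simp

lemma realisations_nonempty:
  assumes "random_substitution \<theta>"
  shows "realisations \<theta> u \<noteq> {}"
proof (induction u)
  case (Cons a u)
  moreover have "\<theta> a \<noteq> {}" using assms by (simp add: random_substitution_def)
  ultimately show ?case unfolding realisations_Cons by blast
qed simp

text \<open>This transfers prefix arguments to suffixes. One inclusion is an induction; the other is
  the same inclusion for the reversed substitution, as reversal is an involution.\<close>

lemma realisations_rev:
  "realisations (\<lambda>a. rev ` \<theta> a) (rev u) = rev ` realisations \<theta> u"
proof -
  have sub: "rev ` realisations \<theta> u \<subseteq> realisations (\<lambda>a. rev ` \<theta> a) (rev u)"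
    for \<theta> :: "'a \<Rightarrow> 'a list set" and u
  proof (induction u)
    case (Cons a u)
    have "rev y @ rev x \<in> realisations (\<lambda>a. rev ` \<theta> a) (rev u @ [a])"
      if "x \<in> \<theta> a" "y \<in> realisations \<theta> u" for x y
      using that Cons by (intro realisations_append) (auto simp: realisations_Cons)
    then show ?case by (auto simp: realisations_Cons)
  qed simp
  have "rev ` realisations (\<lambda>a. rev ` \<theta> a) (rev u) \<subseteq> realisations \<theta> u"
    using sub[of "\<lambda>a. rev ` \<theta> a" "rev u"] by (simp add: image_image)
  then have "rev ` rev ` realisations (\<lambda>a. rev ` \<theta> a) (rev u) \<subseteq> rev ` realisations \<theta> u"
    by (rule image_mono)
  then have "realisations (\<lambda>a. rev ` \<theta> a) (rev u) \<subseteq> rev ` realisations \<theta> u"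
    by (simp add: image_image)
  with sub show ?thesis by blast
qed

lemma length_realisations:
  assumes "\<And>a x. x \<in> \<theta> a \<Longrightarrow> length x \<le> K" "y \<in> realisations \<theta> u"
  shows "length y \<le> K * length u"
  using assms(2)
proof (induction u arbitrary: y)
  case (Cons a u)
  then show ?case using assms(1) by (fastforce simp: realisations_Cons intro: add_mono)
qed simp

lemma length_iter_realisations:
  assumes "\<And>a x. x \<in> \<theta> a \<Longrightarrow> length x \<le> K" "y \<in> iter_realisations \<theta> k u"
  shows "length y \<le> K ^ k * length u"
  using assms(2)
proof (induction k arbitrary: y)
  case (Suc k)
  then obtain v where v: "v \<in> iter_realisations \<theta> k u" "y \<in> realisations \<theta> v" by auto
  have "length y \<le> K * length v" using assms(1) v(2) by (rule length_realisations)
  also have "\<dots> \<le> K * (K ^ k * length u)" using Suc.IH[OF v(1)] by (rule mult_le_mono2)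
  finally show ?case by (simp add: mult.assoc)
qed simp

lemma iter_realisations_Nil: "[] \<in> iter_realisations \<theta> k []"
  by (induction k) (auto intro!: bexI[of _ "[]"])

lemma iter_realisations_append:
  "x \<in> iter_realisations \<theta> k u \<Longrightarrow> y \<in> iter_realisations \<theta> k v
    \<Longrightarrow> x @ y \<in> iter_realisations \<theta> k (u @ v)"
proof (induction k arbitrary: x y)
  case (Suc k)
  then show ?case by (auto intro!: bexI[of _ "_ @ _"] realisations_append)
qed simp

text \<open>The exponent \<open>k\<close> is the same for all letters, so the realisations of the
  single letters, each containing \<open>a\<close>, can be concatenated, and every letter of
  \<open>y\<close> contributes at least one \<open>a\<close>.\<close>

lemma ex_iter_realisation_count_ge:
  assumes "\<And>b. \<exists>v\<in>iter_realisations \<theta> k [b]. sublist [a] v"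
  shows "\<exists>x\<in>iter_realisations \<theta> k y. length y \<le> count_list x a"
proof (induction y)
  case Nil
  then show ?case using iter_realisations_Nil[of \<theta> k] by auto
next
  case (Cons b y)
  then obtain x where x: "x \<in> iter_realisations \<theta> k y" "length y \<le> count_list x a" by auto
  obtain v where v: "v \<in> iter_realisations \<theta> k [b]" "sublist [a] v" using assms by auto
  from v(2) have "1 \<le> count_list v a" by (auto simp: sublist_def)
  then show ?case using iter_realisations_append[OF v(1) x(1)] x(2)
    by (intro bexI[of _ "v @ x"]) auto
qed

text \<open>If \<open>u\<close> occurs in a realisation of level \<open>k\<close>, completing
  \<open>z\<close> by arbitrary realisations of the surrounding words shows that \<open>z\<close>
  occurs at level \<open>k + 1\<close>.\<close>

lemma legal_realisation:
  assumes rs: "random_substitution \<theta>" and u: "legal \<theta> u" and z: "z \<in> realisations \<theta> u"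
  shows "legal \<theta> z"
proof -
  obtain k a v where v: "v \<in> iter_realisations \<theta> k [a]" "sublist u v" and "u \<noteq> []"
    using u unfolding legal_def by blast
  then obtain p s where it: "p @ u @ s \<in> iter_realisations \<theta> k [a]"
    unfolding sublist_def by blast
  have "z \<noteq> []"
    using \<open>u \<noteq> []\<close> z rs by (cases u) (auto simp: realisations_Cons random_substitution_def)
  obtain p' s' where "p' \<in> realisations \<theta> p" "s' \<in> realisations \<theta> s"
    using realisations_nonempty[OF rs] by blast
  with z have "p' @ z @ s' \<in> realisations \<theta> (p @ u @ s)" by (intro realisations_append)
  with it have "p' @ z @ s' \<in> iter_realisations \<theta> (Suc k) [a]" by auto
  then show ?thesis unfolding legal_def using \<open>z \<noteq> []\<close> by blast
qed

lemma legal_sublist: "legal \<theta> v \<Longrightarrow> sublist u v \<Longrightarrow> u \<noteq> [] \<Longrightarrow> legal \<theta> u"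
  unfolding legal_def using sublist_order.order.trans by blast

section \<open>The language of the subshift\<close>

text \<open>Legality of \<open>z\<close> alone does not yield a sequence containing it. Instead a
  whole sequence \<open>w\<close> containing \<open>y\<close> is substituted, with the blocks of
  \<open>z\<close> on \<open>y\<close> and arbitrary realisations elsewhere. Each factor of the
  result lies in a realisation of a factor of \<open>w\<close>, hence is legal.\<close>

lemma language_realisation:
  assumes rs: "random_substitution \<theta>" and y: "y \<in> language (RS_subshift \<theta>)"
    and z: "z \<in> realisations \<theta> y"
  shows "z \<in> language (RS_subshift \<theta>)"
proof -
  obtain w i n where w: "w \<in> RS_subshift \<theta>" and y: "y = factor w i n"
    using y by (auto simp: language_def)
  obtain xs where xs: "z = concat xs" "list_all2 (\<lambda>x a. x \<in> \<theta> a) xs y"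
    using z by (auto simp: realisations_def)
  have len: "length xs = n" using xs(2) y by (auto dest: list_all2_lengthD)
  \<comment> \<open>The index is shifted by \<open>i\<close>, so that \<open>y\<close> occupies the
    blocks 0 to \<open>n - 1\<close> and \<open>z\<close> starts at position 0 of the new
    sequence.\<close>
  define B where "B j = (if 0 \<le> j \<and> j < int n then xs ! nat j else SOME x. x \<in> \<theta> (w (i + j)))" for j
  have B: "B j \<in> \<theta> (w (i + j))" for j
  proof (cases "0 \<le> j \<and> j < int n")
    case True
    then have j: "nat j < n" by auto
    then have "xs ! nat j \<in> \<theta> (factor w i n ! nat j)"
      using xs(2) len y by (simp add: list_all2_conv_all_nth del: nth_factor)
    with True j show ?thesis by (simp add: B_def)
  next
    case False
    have "\<theta> (w (i + j)) \<noteq> {}" using rs by (simp add: random_substitution_def)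
    then show ?thesis using False by (auto simp: B_def some_in_eq)
  qed
  have B_ne: "B j \<noteq> []" for j using B[of j] rs by (metis random_substitution_def)
  have B_xs: "factor B 0 n = xs" using len by (intro nth_equalityI) (auto simp: B_def)
  obtain w' where
    w'0: "\<forall>n. factor w' 0 (length (concat (factor B 0 n))) = concat (factor B 0 n)"
    and w': "\<forall>i l. \<exists>n. sublist (factor w' i l) (concat (factor B (- int n) (n + n)))"
    using bi_infinite_concat[of B, OF B_ne] by (elim exE conjE)
  have "z = factor w' 0 (length z)" using w'0[rule_format, of n] by (simp only: B_xs xs(1))
  moreover have "w' \<in> RS_subshift \<theta>"
    unfolding RS_subshift_def
  proof (intro CollectI allI impI)
    fix j and l :: nat assume l: "0 < l"
    obtain m where m: "sublist (factor w' j l) (concat (factor B (- int m) (m + m)))" using w' by blast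
    have "list_all2 (\<lambda>x a. x \<in> \<theta> a) (factor B (- int m) (m + m)) (factor w (i - int m) (m + m))"
      using B by (auto simp: list_all2_conv_all_nth add.assoc diff_conv_add_uminus simp del: add_uminus_conv_diff)
    then have "concat (factor B (- int m) (m + m)) \<in> realisations \<theta> (factor w (i - int m) (m + m))"
      by (auto simp: realisations_def)
    \<comment> \<open>Membership in the subshift gives legality of factors of positive length
      only.\<close>
    moreover have "m \<noteq> 0"
    proof
      assume "m = 0"
      with m have "factor w' j l = []" by simp
      with l show False by (metis length_factor list.size(3) less_irrefl)
    qed
    then have "legal \<theta> (factor w (i - int m) (m + m))" using w by (simp add: RS_subshift_def)
    ultimately have "legal \<theta> (concat (factor B (- int m) (m + m)))"
      using legal_realisation[OF rs] by blast
    moreover have "factor w' j l \<noteq> []" using l by (metis length_factor list.size(3) less_irrefl)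
    ultimately show "legal \<theta> (factor w' j l)" using m legal_sublist by blast
  qed
  ultimately show ?thesis unfolding language_def by blast
qed

lemma language_iter_realisation:
  assumes "random_substitution \<theta>" "y \<in> language (RS_subshift \<theta>)"
  shows "iter_realisations \<theta> k y \<subseteq> language (RS_subshift \<theta>)"
  by (induction k) (use assms language_realisation in auto)

section \<open>Branching at a splitting pair\<close>

text \<open>Induction along \<open>x\<close>: at an \<open>a\<close> both \<open>u\<close> and
  \<open>v\<close> are prepended, which doubles the set, and at any other letter one fixed
  realisation. A common head cancels from a prefix relation, while the incomparable heads
  \<open>u\<close> and \<open>v\<close> exclude one.\<close>

lemma prefix_free_realisations:
  assumes rs: "\<And>b. \<theta> b \<noteq> {}" and uv: "u \<in> \<theta> a" "v \<in> \<theta> a" "\<not> prefix u v" "\<not> prefix v u"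
  shows "\<exists>S \<subseteq> realisations \<theta> x. card S = 2 ^ count_list x a \<and>
    (\<forall>y\<in>S. \<forall>z\<in>S. prefix y z \<longrightarrow> y = z)"
proof (induction x)
  case Nil
  show ?case by (intro exI[of _ "{[]}"]) auto
next
  case (Cons b x)
  then obtain S where S: "S \<subseteq> realisations \<theta> x" "card S = 2 ^ count_list x a"
    "\<forall>y\<in>S. \<forall>z\<in>S. prefix y z \<longrightarrow> y = z" by auto
  \<comment> \<open>An infinite set would have \<open>card\<close> 0, which is not a power of
    2.\<close>
  then have fin: "finite S" by (metis card.infinite power_not_zero zero_neq_numeral)
  have inj: "card ((@) p ` S) = card S" for p by (intro card_image inj_onI) auto
  show ?case
  proof (cases "b = a")
    case True
    \<comment> \<open>Otherwise \<open>u\<close> and \<open>v\<close> would be prefixes of one word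
      and so comparable.\<close>
    have branch: "\<not> prefix (u @ y) (v @ z)" "\<not> prefix (v @ y) (u @ z)" for y z
      using uv(3,4) by (meson append_prefixD prefixI prefix_same_cases)+
    let ?T = "(@) u ` S \<union> (@) v ` S"
    have "u @ y \<noteq> v @ z" for y z using branch(1)[of y z] by auto
    then have "(@) u ` S \<inter> (@) v ` S = {}" by blast
    then have "card ?T = 2 ^ count_list (b # x) a"
      using True S(2) fin inj by (simp add: card_Un_disjoint)
    moreover have "?T \<subseteq> realisations \<theta> (b # x)"
      using True S(1) uv by (auto simp: realisations_Cons)
    moreover have "\<forall>y\<in>?T. \<forall>z\<in>?T. prefix y z \<longrightarrow> y = z" using S(3) branch by auto
    ultimately show ?thesis by blast
  next
    case False
    obtain p where "p \<in> \<theta> b" using rs by blast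
    then have "(@) p ` S \<subseteq> realisations \<theta> (b # x)" using S(1) by (auto simp: realisations_Cons)
    moreover have "card ((@) p ` S) = 2 ^ count_list (b # x) a" using False S(2) inj by simp
    moreover have "\<forall>y\<in>(@) p ` S. \<forall>z\<in>(@) p ` S. prefix y z \<longrightarrow> y = z" using S(3) by auto
    ultimately show ?thesis by blast
  qed
qed

lemma suffix_free_realisations:
  assumes "\<And>b. \<theta> b \<noteq> {}" and "u \<in> \<theta> a" "v \<in> \<theta> a" "\<not> suffix u v" "\<not> suffix v u"
  shows "\<exists>S \<subseteq> realisations \<theta> x. card S = 2 ^ count_list x a \<and>
    (\<forall>y\<in>S. \<forall>z\<in>S. suffix y z \<longrightarrow> y = z)"
proof -
  have "\<exists>S \<subseteq> realisations (\<lambda>b. rev ` \<theta> b) (rev x). card S = 2 ^ count_list (rev x) a \<and>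
    (\<forall>y\<in>S. \<forall>z\<in>S. prefix y z \<longrightarrow> y = z)"
    by (rule prefix_free_realisations[where u = "rev u" and v = "rev v"])
      (use assms in \<open>auto simp: suffix_to_prefix\<close>)
  then obtain S where S: "S \<subseteq> rev ` realisations \<theta> x" "card S = 2 ^ count_list x a"
    "\<forall>y\<in>S. \<forall>z\<in>S. prefix y z \<longrightarrow> y = z" by (auto simp: realisations_rev)
  have "card (rev ` S) = card S" by (intro card_image inj_onI) auto
  then show ?thesis using S by (intro exI[of _ "rev ` S"]) (auto simp: suffix_to_prefix)
qed

lemma complexity_ge_two_power:
  assumes rs: "random_substitution \<theta>" and split: "admits_splitting_pair \<theta> a"
    and K: "\<And>b x. x \<in> \<theta> b \<Longrightarrow> length x \<le> K"
    and x: "x \<in> language (RS_subshift \<theta>)" and M: "K * length x \<le> M"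
  shows "2 ^ count_list x a \<le> complexity (RS_subshift \<theta>) M"
proof -
  have ne: "\<theta> b \<noteq> {}" for b using rs by (simp add: random_substitution_def)
  have lang: "realisations \<theta> x \<subseteq> language (RS_subshift \<theta>)"
    using language_realisation[OF rs x] by blast
  have len: "length z \<le> M" if "z \<in> realisations \<theta> x" for z
  proof -
    have "length z \<le> K * length x" using K that by (rule length_realisations)
    with M show ?thesis by linarith
  qed
  obtain u v where uv: "u \<in> \<theta> a" "v \<in> \<theta> a" "length u \<le> length v" "\<not> prefix u v \<or> \<not> suffix u v"
    using split by (auto simp: admits_splitting_pair_def strong_affix_def)
  show ?thesis
  proof (cases "prefix u v")
    case False
    \<comment> \<open>As \<open>u\<close> is not longer than \<open>v\<close>, a prefix
      \<open>v\<close> of \<open>u\<close> would equal \<open>u\<close>. The same length argument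
      serves for suffixes in the other case.\<close>
    moreover have "\<not> prefix v u" using False uv(3) by (auto simp: prefix_def)
    ultimately obtain S where S: "S \<subseteq> realisations \<theta> x" "card S = 2 ^ count_list x a"
      "\<forall>y\<in>S. \<forall>z\<in>S. prefix y z \<longrightarrow> y = z"
      using prefix_free_realisations[of \<theta> u a v x, OF ne uv(1,2)] by blast
    have "card S \<le> complexity (RS_subshift \<theta>) M"
      by (rule complexity_ge_card_prefix_free) (use S(1,3) lang len in blast)+
    then show ?thesis by (simp add: S(2))
  next
    case True
    then have "\<not> suffix u v" using uv(4) by simp
    moreover from this have "\<not> suffix v u" using uv(3) by (auto simp: suffix_def)
    ultimately obtain S where S: "S \<subseteq> realisations \<theta> x" "card S = 2 ^ count_list x a"
      "\<forall>y\<in>S. \<forall>z\<in>S. suffix y z \<longrightarrow> y = z"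
      using suffix_free_realisations[of \<theta> u a v x, OF ne uv(1,2)] by metis
    have "card S \<le> complexity (RS_subshift \<theta>) M"
      by (rule complexity_ge_card_suffix_free) (use S(1,3) lang len in blast)+
    then show ?thesis by (simp add: S(2))
  qed
qed

lemma bounded_lengths:
  fixes \<theta> :: "'a::finite \<Rightarrow> 'a list set"
  assumes "random_substitution \<theta>"
  obtains K where "K > 0" "\<And>b x. x \<in> \<theta> b \<Longrightarrow> length x \<le> K"
proof -
  have "finite (\<Union>b. \<theta> b)" using assms by (auto simp: random_substitution_def)
  then have "finite (length ` (\<Union>b. \<theta> b))" by (rule finite_imageI)
  then obtain K where "\<forall>n\<in>length ` (\<Union>b. \<theta> b). n \<le> K" using finite_nat_set_iff_bounded_le by blast
  then show ?thesis by (intro that[of "Suc K"]) (auto intro: le_SucI)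
qed

theorem corollary34:
  fixes \<theta> :: "'a::finite \<Rightarrow> 'a list set"
  assumes "random_substitution \<theta>"
    and "primitive \<theta>"
    and "RS_subshift \<theta> \<noteq> {}"
    and "\<exists>a. admits_splitting_pair \<theta> a"
  shows "h_top (RS_subshift \<theta>) > 0"
proof -
  let ?X = "RS_subshift \<theta>" and ?h = "\<lambda>l. ln (real (complexity (RS_subshift \<theta>) l)) / real l"
  obtain a where a: "admits_splitting_pair \<theta> a" using assms(4) by blast
  obtain k where k: "\<And>b. \<exists>v\<in>iter_realisations \<theta> k [b]. sublist [a] v"
    using assms(2) by (auto simp: primitive_def)
  obtain K where K: "K > 0" "\<And>b x. x \<in> \<theta> b \<Longrightarrow> length x \<le> K"
    using bounded_lengths[OF assms(1)] by blast
  obtain w where w: "w \<in> ?X" using assms(3) by blast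
  \<comment> \<open>A factor \<open>K ^ k\<close> pays for the iterate that produces the occurrences
    of \<open>a\<close>, and one more \<open>K\<close> for the final substitution that branches at
    them.\<close>
  define D where "D = K ^ Suc k"
  have D: "D > 0" using K(1) by (simp add: D_def)
  have exp_growth: "2 ^ n \<le> complexity ?X (D * n)" for n
  proof -
    obtain x where x: "x \<in> iter_realisations \<theta> k (factor w 0 n)" "n \<le> count_list x a"
      using ex_iter_realisation_count_ge[of \<theta>, OF k] by (metis length_factor)
    have "factor w 0 n \<in> language ?X" using w by (auto simp: language_def)
    then have "x \<in> language ?X" using language_iter_realisation[OF assms(1)] x(1) by blast
    moreover have "length x \<le> K ^ k * n" using length_iter_realisations[OF K(2) x(1)] by simp
    then have "K * length x \<le> D * n" by (simp add: D_def mult.assoc)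
    ultimately have "2 ^ count_list x a \<le> complexity ?X (D * n)"
      by (rule complexity_ge_two_power[OF assms(1) a, rotated]) (rule K(2))
    moreover have "(2::nat) ^ n \<le> 2 ^ count_list x a" using x(2) by (rule power_increasing) simp
    ultimately show ?thesis by linarith
  qed
  have "ln 2 / real D \<le> ?h (D * n)" if n: "n \<ge> 1" for n
  proof -
    have "real (2 ^ n) \<le> real (complexity ?X (D * n))"
      using exp_growth[of n] by (simp only: of_nat_le_iff)
    then have "ln (real (2 ^ n)) \<le> ln (real (complexity ?X (D * n)))" by (rule ln_mono) simp
    then have "real n * ln 2 \<le> ln (real (complexity ?X (D * n)))" by (simp add: ln_realpow)
    then show ?thesis using n D by (simp add: field_simps)
  qed
  moreover have "?h \<longlonglongrightarrow> h_top ?X"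
    using convergent_entropy[OF assms(3)] unfolding h_top_def convergent_LIMSEQ_iff .
  \<comment> \<open>The lower bound is available only at multiples of \<open>D\<close>; since the
    full limit exists, it equals the limit along them.\<close>
  then have "(?h \<circ> (\<lambda>n. D * n)) \<longlonglongrightarrow> h_top ?X"
    using D by (intro LIMSEQ_subseq_LIMSEQ) (auto simp: strict_mono_def)
  ultimately have "ln 2 / real D \<le> h_top ?X"
    by (intro LIMSEQ_le_const[of "?h \<circ> (\<lambda>n. D * n)"] exI[of _ 1]) simp_all
  moreover have "ln 2 / real D > 0" using D by simp
  ultimately show ?thesis by linarith
qed

end
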